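(* Let $\nu\ge 0$ be fixed and consider the complex Burgers equation on the torus, $u_t-6uu_x-\nu u_{xx}=0$ for $x\in\mathbf{T}=\mathbf{R}/(2\pi\mathbf{Z})$, $t>0$, with $u(x,0)=u_0(x)$. For every sufficiently large $T>0$ (that is, for every $T\ge T_0$ for some $T_0$ depending only on $\nu$), there exists an initial datum of the form $u_0(x)=a\,e^{ix}$, with $a$ a constant, such that the corresponding solution $u(x,t)=\sum_{k=1}^\infty a_k(t)e^{ikx}$ blows up at $t=T$ in the $L^2$-norm, namely $$\|u(\cdot,T)\|_{L^2(\mathbf{T})}^2=\sum_{k=1}^\infty |a_k(T)|^2=\infty .$$
   Context: $u=u(x,t)$ is complex-valued and $2\pi$-periodic in $x$. For a function $\sum_{k\ge1}a_k e^{ikx}$ the (normalized) norm is $\|u\|_{L^2(\mathbf{T})}^2=\sum_{k\ge1}|a_k|^2$. The solution corresponding to $u_0(x)=a e^{ix}$ is represented by the Fourier series $u(x,t)=\sum_{k=1}^\infty a_k(t)e^{ikx}$, whose coefficients are determined for all $t\ge0$ by the equation: $a_1(t)=a e^{-\nu t}$ and, for $k\ge2$, $$a_k(t)=3ik\,e^{-\nu k^2t}\int_0^t e^{\nu k^2\tau}\sum_{k_1+k_2=k,\ k_1,k_2\ge1}a_{k_1}(\tau)a_{k_2}(\tau)\,d\tau .$$ *)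

theory Defs
  imports "HOL-Analysis.Analysis"
begin

text \<open>
  Fourier coefficients of the solution \<open>u(x,t) = (\<Sum>k\<ge>1. a\<^sub>k(t) e\<^sup>i\<^sup>k\<^sup>x)\<close> of the complex Burgers equation
  \<open>u\<^sub>t - 6 u u\<^sub>x - \<nu> u\<^sub>x\<^sub>x = 0\<close> with datum \<open>u(x,0) = a e\<^sup>i\<^sup>x\<close>, as determined by Duhamel's formula for
  each mode. Index \<open>0\<close> is not a mode of the solution and is given the value \<open>0\<close>; only times
  \<open>t \<ge> 0\<close> are meaningful.
\<close>

function burgers_coeff :: "real \<Rightarrow> complex \<Rightarrow> nat \<Rightarrow> real \<Rightarrow> complex" where
  "burgers_coeff \<nu> a k t =
     (if k = 0 then 0
      else if k = 1 then a * of_real (exp (- \<nu> * t))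
      else 3 * \<i> * of_nat k * of_real (exp (- \<nu> * (real k)\<^sup>2 * t)) *
           integral {0..t} (\<lambda>\<tau>. of_real (exp (\<nu> * (real k)\<^sup>2 * \<tau>)) *
             (\<Sum>(k1, k2)\<in>{(k1, k2). k1 + k2 = k \<and> k1 \<ge> 1 \<and> k2 \<ge> 1}.
                burgers_coeff \<nu> a k1 \<tau> * burgers_coeff \<nu> a k2 \<tau>)))"
  by pat_completeness auto
termination
  by (relation "Wellfounded.measure (\<lambda>(\<nu>, a, k, t). k)") auto

declare burgers_coeff.simps [simp del]

lemma burgers_coeff_one: "burgers_coeff \<nu> a 1 t = a * of_real (exp (- \<nu> * t))"
  by (simp add: burgers_coeff.simps)

lemma burgers_coeff_ge_2:
  assumes "k \<ge> 2"
  shows "burgers_coeff \<nu> a k t =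
     3 * \<i> * of_nat k * of_real (exp (- \<nu> * (real k)\<^sup>2 * t)) *
       integral {0..t} (\<lambda>\<tau>. of_real (exp (\<nu> * (real k)\<^sup>2 * \<tau>)) *
         (\<Sum>(k1, k2)\<in>{(k1, k2). k1 + k2 = k \<and> k1 \<ge> 1 \<and> k2 \<ge> 1}.
            burgers_coeff \<nu> a k1 \<tau> * burgers_coeff \<nu> a k2 \<tau>))"
  using assms by (subst burgers_coeff.simps) simp

lemma burgers_coeff_initial: "burgers_coeff \<nu> a k 0 = (if k = 1 then a else 0)"
  by (subst burgers_coeff.simps) simp

text \<open>
  Mode by mode, the coefficients satisfy \<open>u\<^sub>t = 3 (u\<^sup>2)\<^sub>x + \<nu> u\<^sub>x\<^sub>x\<close>, i.e. the Burgers equation above.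
\<close>

lemma burgers_coeff_ode:
  assumes "t \<ge> 0"
  shows "(burgers_coeff \<nu> a k has_vector_derivative
           3 * \<i> * of_nat k * (\<Sum>(k1, k2)\<in>{(k1, k2). k1 + k2 = k \<and> k1 \<ge> 1 \<and> k2 \<ge> 1}.
              burgers_coeff \<nu> a k1 t * burgers_coeff \<nu> a k2 t)
           - of_real (\<nu> * (real k)\<^sup>2) * burgers_coeff \<nu> a k t) (at t within {0..})"
  using assms
proof (induction k arbitrary: t rule: less_induct)
  case (less k)
  define P where "P = {(k1, k2). k1 + k2 = k \<and> k1 \<ge> 1 \<and> k2 \<ge> (1::nat)}"
  define S where "S = (\<lambda>\<tau>. \<Sum>(k1, k2)\<in>P. burgers_coeff \<nu> a k1 \<tau> * burgers_coeff \<nu> a k2 \<tau>)"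
  define \<mu> where "\<mu> = \<nu> * (real k)\<^sup>2"
  have cont: "continuous_on {0..} (burgers_coeff \<nu> a j)" if "j < k" for j
    by (rule continuous_on_vector_derivative, rule less.IH[OF that]) simp
  consider "k = 0" | "k = 1" | "k \<ge> 2" by linarith
  then show ?case
  proof cases
    case 1
    then have "burgers_coeff \<nu> a k = (\<lambda>_. 0)"
      by (intro ext, subst burgers_coeff.simps) simp
    with 1 show ?thesis by simp
  next
    case 2
    have P: "P = {}" using 2 by (auto simp: P_def)
    have eq: "burgers_coeff \<nu> a k = (\<lambda>t. a * of_real (exp (- \<nu> * t)))"
      unfolding 2 by (intro ext burgers_coeff_one)
    show ?thesis unfolding P_def[symmetric] P unfolding eq using 2
      by (auto intro!: derivative_eq_intros simp: has_vector_derivative_def scaleR_conv_of_real algebra_simps)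
  next
    case 3
    define g where "g = (\<lambda>\<tau>. complex_of_real (exp (\<mu> * \<tau>)) * S \<tau>)"
    have contS: "continuous_on {0..} S"
      unfolding S_def P_def by (intro continuous_on_sum) (auto intro!: continuous_on_mult cont)
    have "continuous_on {0..t+1} g"
      unfolding g_def by (intro continuous_intros continuous_on_subset[OF contS]) auto
    then have "((\<lambda>s. integral {0..s} g) has_vector_derivative g t) (at t within {0..t+1})"
      by (rule integral_has_vector_derivative) (use less.prems in auto)
    moreover have "at t within {0..t+1} = at t within {0..}"
      by (rule at_within_nhd[of _ "{t-1<..<t+1}"]) auto
    ultimately have G: "((\<lambda>s. integral {0..s} g) has_vector_derivative g t) (at t within {0..})"
      by simp
    have E: "((\<lambda>s. complex_of_real (exp (- \<mu> * s))) has_vector_derivative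
               of_real (- \<mu> * exp (- \<mu> * t))) (at t within {0..})"
      by (intro has_vector_derivative_of_real) (auto intro!: derivative_eq_intros)
    have eq: "burgers_coeff \<nu> a k =
        (\<lambda>s. 3 * \<i> * of_nat k * (of_real (exp (- \<mu> * s)) * integral {0..s} g))"
      by (rule ext, subst burgers_coeff_ge_2[OF 3])
         (simp add: g_def S_def P_def \<mu>_def mult.assoc)
    have exps: "complex_of_real (exp (- \<mu> * t)) * of_real (exp (\<mu> * t)) = 1"
      by (simp flip: of_real_mult exp_add)
    have "of_real (exp (- \<mu> * t)) * g t = S t"
      unfolding g_def using exps by (simp only: mult.assoc[symmetric] mult_1_left)
    then have "3 * \<i> * of_nat k * (of_real (exp (- \<mu> * t)) * g t
          + of_real (- \<mu> * exp (- \<mu> * t)) * integral {0..t} g)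
        = 3 * \<i> * of_nat k * S t - of_real \<mu> * burgers_coeff \<nu> a k t"
      unfolding eq by (simp only: of_real_mult of_real_minus) (simp add: algebra_simps)
    moreover have "(burgers_coeff \<nu> a k has_vector_derivative
        3 * \<i> * of_nat k * (of_real (exp (- \<mu> * t)) * g t
          + of_real (- \<mu> * exp (- \<mu> * t)) * integral {0..t} g)) (at t within {0..})"
      unfolding eq by (intro has_vector_derivative_mult_right has_vector_derivative_mult E G)
    ultimately show ?thesis
      by (simp only: S_def P_def \<mu>_def)
  qed
qed

text \<open>The squared normalized norm of \<open>\<Sum>k\<ge>1. c\<^sub>k e\<^sup>i\<^sup>k\<^sup>x\<close> in \<open>L\<^sup>2\<close>, with values in \<open>[0, \<infinity>]\<close>.\<close>

definition L2_norm_sq :: "(nat \<Rightarrow> complex) \<Rightarrow> ennreal" where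
  "L2_norm_sq c = (\<Sum>k. ennreal ((cmod (c (Suc k)))\<^sup>2))"

end

theory Submission imports Defs begin

text \<open>
  For real \<open>a > 0\<close> the coefficients have the form \<open>a\<^sub>k = \<i>\<^sup>k\<^sup>-\<^sup>1 |a\<^sub>k|\<close>, so no cancellation occurs in the
  convolution and the moduli satisfy a monotone recursion. It admits on \<open>[0,T]\<close> the subsolution
  \<open>B \<rho>\<^sup>k t\<^sup>k\<^sup>-\<^sup>1\<close> with \<open>B = 1 + \<nu> T\<close> as soon as \<open>a e\<^sup>-\<^sup>\<nu>\<^sup>T \<ge> B \<rho>\<close>. For \<open>\<rho> = 1/T\<close> the moduli at time \<open>T\<close> are
  bounded below by \<open>B/T\<close>, uniformly in \<open>k\<close>.
\<close>

text \<open>An abbreviation, not a constant: terms using it coincide with the index set in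
  \<open>burgers_coeff_ge_2\<close>, so that equation applies without unfolding.\<close>

abbreviation conv_pairs :: "nat \<Rightarrow> (nat \<times> nat) set" where
  "conv_pairs k \<equiv> {(k1, k2). k1 + k2 = k \<and> k1 \<ge> 1 \<and> k2 \<ge> 1}"

lemma conv_pairs_eq_image:
  "conv_pairs k = (\<lambda>j. (j, k - j)) ` {1..<k}"
  by (auto simp: image_iff)

lemma finite_conv_pairs [simp]: "finite (conv_pairs k)"
  unfolding conv_pairs_eq_image by simp

lemma card_conv_pairs: "card (conv_pairs k) = k - 1"
  unfolding conv_pairs_eq_image by (subst card_image) (auto simp: inj_on_def)

lemma continuous_on_burgers_coeff: "continuous_on {0..} (burgers_coeff \<nu> a k)"
  by (rule continuous_on_vector_derivative, rule burgers_coeff_ode) simp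

text \<open>For \<open>k1 + k2 = k\<close> the phases multiply to
  \<open>\<i> ^ (k1 - 1) * \<i> ^ (k2 - 1) = \<i> ^ (k - 2)\<close>, the same for every split, so
  the phase leaves both the sum and the integral; the factor \<open>\<i>\<close> in the recursion
  raises the exponent to \<open>k - 1\<close>. The phases of the lower modes are a premise so that
  the step can serve inside the induction proving them.\<close>

lemma burgers_coeff_step:
  assumes k: "k \<ge> 2"
    and phase: "\<And>j \<tau>. 1 \<le> j \<Longrightarrow> j < k \<Longrightarrow> 0 \<le> \<tau> \<Longrightarrow>
      burgers_coeff \<nu> a j \<tau> = \<i> ^ (j - 1) * of_real (cmod (burgers_coeff \<nu> a j \<tau>))"
  shows "burgers_coeff \<nu> a k t = \<i> ^ (k - 1) *
    of_real (3 * real k * exp (- \<nu> * (real k)\<^sup>2 * t) *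
      integral {0..t} (\<lambda>\<tau>. exp (\<nu> * (real k)\<^sup>2 * \<tau>) *
        (\<Sum>(k1, k2)\<in>conv_pairs k. cmod (burgers_coeff \<nu> a k1 \<tau>) * cmod (burgers_coeff \<nu> a k2 \<tau>))))"
proof -
  define g where "g = (\<lambda>\<tau>. exp (\<nu> * (real k)\<^sup>2 * \<tau>) *
        (\<Sum>(k1, k2)\<in>conv_pairs k. cmod (burgers_coeff \<nu> a k1 \<tau>) * cmod (burgers_coeff \<nu> a k2 \<tau>)))"
  have prod_phase: "burgers_coeff \<nu> a k1 \<tau> * burgers_coeff \<nu> a k2 \<tau> = \<i> ^ (k - 2) *
      of_real (cmod (burgers_coeff \<nu> a k1 \<tau>) * cmod (burgers_coeff \<nu> a k2 \<tau>))"
    if "k1 + k2 = k" "k1 \<ge> 1" "k2 \<ge> 1" "0 \<le> \<tau>" for k1 k2 \<tau>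
  proof -
    have "k - 2 = (k1 - 1) + (k2 - 1)" using that by simp
    then have "\<i> ^ (k - 2) = \<i> ^ (k1 - 1) * \<i> ^ (k2 - 1)"
      by (simp only: power_add)
    moreover have "burgers_coeff \<nu> a k1 \<tau> * burgers_coeff \<nu> a k2 \<tau> =
      (\<i> ^ (k1 - 1) * of_real (cmod (burgers_coeff \<nu> a k1 \<tau>))) *
      (\<i> ^ (k2 - 1) * of_real (cmod (burgers_coeff \<nu> a k2 \<tau>)))"
      using phase[of k1 \<tau>] phase[of k2 \<tau>] that by simp
    ultimately show ?thesis by (simp add: mult_ac)
  qed
  have "integral {0..t} (\<lambda>\<tau>. of_real (exp (\<nu> * (real k)\<^sup>2 * \<tau>)) *
      (\<Sum>(k1, k2)\<in>conv_pairs k. burgers_coeff \<nu> a k1 \<tau> * burgers_coeff \<nu> a k2 \<tau>))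
    = integral {0..t} (\<lambda>\<tau>. \<i> ^ (k - 2) * complex_of_real (g \<tau>))"
  proof (rule integral_cong)
    fix \<tau> assume "\<tau> \<in> {0..t}"
    then have "(\<Sum>(k1, k2)\<in>conv_pairs k. burgers_coeff \<nu> a k1 \<tau> * burgers_coeff \<nu> a k2 \<tau>)
      = (\<Sum>(k1, k2)\<in>conv_pairs k. \<i> ^ (k - 2) *
          of_real (cmod (burgers_coeff \<nu> a k1 \<tau>) * cmod (burgers_coeff \<nu> a k2 \<tau>)))"
      using prod_phase by (intro sum.cong) auto
    then show "of_real (exp (\<nu> * (real k)\<^sup>2 * \<tau>)) *
      (\<Sum>(k1, k2)\<in>conv_pairs k. burgers_coeff \<nu> a k1 \<tau> * burgers_coeff \<nu> a k2 \<tau>)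
      = \<i> ^ (k - 2) * complex_of_real (g \<tau>)"
      unfolding g_def by (simp add: sum_distrib_left case_prod_unfold mult_ac)
  qed
  also have "\<dots> = \<i> ^ (k - 2) * of_real (integral {0..t} g)"
  proof -
    have "continuous_on {0..t} g"
      unfolding g_def case_prod_unfold
      by (intro continuous_intros continuous_on_subset[OF continuous_on_burgers_coeff]) auto
    then have "((\<lambda>\<tau>. \<i> ^ (k - 2) * complex_of_real (g \<tau>)) has_integral
        \<i> ^ (k - 2) * of_real (integral {0..t} g)) {0..t}"
      by (intro has_integral_mult_right has_integral_of_real integrable_integral
          integrable_continuous_interval)
    then show ?thesis by (rule integral_unique)
  qed
  finally have "burgers_coeff \<nu> a k t =
    (\<i> * \<i> ^ (k - 2)) * of_real (3 * real k * exp (- \<nu> * (real k)\<^sup>2 * t) * integral {0..t} g)"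
    unfolding burgers_coeff_ge_2[OF k] by (simp add: mult_ac)
  moreover have "\<i> * \<i> ^ (k - 2) = \<i> ^ (k - 1)"
    using k by (cases k; cases "k - 1") auto
  ultimately show ?thesis unfolding g_def by simp
qed

text \<open>Strong induction: the first mode is real and nonnegative, and for
  \<open>k \<ge> 2\<close> the real factor next to \<open>\<i> ^ (k - 1)\<close> is nonnegative,
  hence equal to the modulus.\<close>

lemma burgers_coeff_phase:
  assumes "r \<ge> 0" "k \<ge> 1" "t \<ge> 0"
  shows "burgers_coeff \<nu> (of_real r) k t =
    \<i> ^ (k - 1) * of_real (cmod (burgers_coeff \<nu> (of_real r) k t))"
  using assms(2,3)
proof (induction k arbitrary: t rule: less_induct)
  case (less k)
  show ?case
  proof (cases "k = 1")
    case True
    then show ?thesis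
      using assms(1) by (simp add: burgers_coeff_one[simplified] norm_mult)
  next
    case False
    then have k: "k \<ge> 2" using less.prems by simp
    define g where "g = (\<lambda>\<tau>. exp (\<nu> * (real k)\<^sup>2 * \<tau>) *
        (\<Sum>(k1, k2)\<in>conv_pairs k. cmod (burgers_coeff \<nu> (of_real r) k1 \<tau>) *
           cmod (burgers_coeff \<nu> (of_real r) k2 \<tau>)))"
    define N where "N = 3 * real k * exp (- \<nu> * (real k)\<^sup>2 * t) * integral {0..t} g"
    have eq: "burgers_coeff \<nu> (of_real r) k t = \<i> ^ (k - 1) * of_real N"
      unfolding N_def g_def by (rule burgers_coeff_step[OF k]) (rule less.IH)
    have "g \<tau> \<ge> 0" for \<tau>
      unfolding g_def by (intro mult_nonneg_nonneg sum_nonneg) auto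
    \<comment> \<open>A function that is not integrable has integral \<open>0\<close> by convention,
      so the bound holds in either case.\<close>
    then have "integral {0..t} g \<ge> 0"
      by (cases "g integrable_on {0..t}") (simp_all add: integral_nonneg not_integrable_integral)
    then have "N \<ge> 0" unfolding N_def by simp
    then show ?thesis unfolding eq by (simp add: norm_mult norm_power)
  qed
qed

text \<open>Two expressions for the same coefficient are compared and the nonzero phase is
  cancelled. All terms of the resulting recursion are nonnegative, so lower bounds pass from lower
  modes to higher ones.\<close>

lemma cmod_burgers_coeff_rec:
  assumes "r \<ge> 0" "k \<ge> 2" "t \<ge> 0"
  shows "cmod (burgers_coeff \<nu> (of_real r) k t) =
    3 * real k * exp (- \<nu> * (real k)\<^sup>2 * t) *
      integral {0..t} (\<lambda>\<tau>. exp (\<nu> * (real k)\<^sup>2 * \<tau>) *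
        (\<Sum>(k1, k2)\<in>conv_pairs k. cmod (burgers_coeff \<nu> (of_real r) k1 \<tau>) *
           cmod (burgers_coeff \<nu> (of_real r) k2 \<tau>)))" (is "?l = ?r")
proof -
  have "\<i> ^ (k - 1) * of_real ?l = \<i> ^ (k - 1) * of_real ?r"
    using burgers_coeff_step[OF assms(2) burgers_coeff_phase[OF assms(1)]]
      burgers_coeff_phase[OF assms(1) _ assms(3), of k] assms(2) by simp
  then show ?thesis by (simp only: mult_cancel_left of_real_eq_iff) simp
qed

text \<open>This is the inequality that makes the profile a subsolution: the left side comes from
  differentiating \<open>exp (\<nu> * k\<^sup>2 * \<tau>) * \<tau> ^ (k - 1)\<close>, the right side
  from the \<open>k - 1\<close> convolution terms. It rests on \<open>k \<le> 2 * (k - 1)\<close>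
  for the viscous term and \<open>1 \<le> 3 * k\<close> for the other.\<close>

lemma subsolution_derivative_bound:
  fixes \<nu> T \<tau> B :: real
  assumes "\<nu> \<ge> 0" "0 \<le> \<tau>" "\<tau> \<le> T" "k \<ge> 2" "B \<ge> 1 + \<nu> * T"
  shows "(real k - 1) + \<nu> * (real k)\<^sup>2 * \<tau> \<le> 3 * real k * (real k - 1) * B"
proof -
  have "\<nu> * (real k)\<^sup>2 * \<tau> \<le> \<nu> * (real k * (2 * (real k - 1))) * T"
    unfolding power2_eq_square using assms by (intro mult_mono mult_left_mono) auto
  also have "\<dots> = 2 * real k * (real k - 1) * (\<nu> * T)" by simp
  also have "\<dots> \<le> 3 * real k * (real k - 1) * (\<nu> * T)"
    using assms by (intro mult_right_mono) auto
  finally have 1: "\<nu> * (real k)\<^sup>2 * \<tau> \<le> 3 * real k * (real k - 1) * (\<nu> * T)" .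
  have 2: "real k - 1 \<le> 3 * real k * (real k - 1)"
    using assms mult_right_mono[of 1 "3 * real k" "real k - 1"] by simp
  have "3 * real k * (real k - 1) * (1 + \<nu> * T) \<le> 3 * real k * (real k - 1) * B"
    using assms by (intro mult_left_mono) auto
  with 1 2 show ?thesis by (simp add: distrib_left)
qed

text \<open>Strong induction on \<open>k\<close>: the lower bounds of modes \<open>k1\<close> and
  \<open>k2\<close> multiply to \<open>B\<^sup>2 * \<rho> ^ k * \<tau> ^ (k - 2)\<close>, whatever
  the split of \<open>k\<close>. The spare factor \<open>B\<close> pays for viscous damping up to
  the fixed horizon \<open>T\<close>.\<close>

lemma cmod_burgers_coeff_lower_bound:
  fixes \<nu> T B \<rho> r :: real
  assumes nu: "\<nu> \<ge> 0" and B: "B \<ge> 1 + \<nu> * T" and rho: "\<rho> \<ge> 0"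
    and r: "r * exp (- \<nu> * T) \<ge> B * \<rho>"
    and "k \<ge> 1" "0 \<le> t" "t \<le> T"
  shows "cmod (burgers_coeff \<nu> (of_real r) k t) \<ge> B * \<rho> ^ k * t ^ (k - 1)"
  using \<open>k \<ge> 1\<close> \<open>0 \<le> t\<close> \<open>t \<le> T\<close>
proof (induction k arbitrary: t rule: less_induct)
  case (less k)
  have T: "T \<ge> 0" using less.prems by simp
  have B0: "B \<ge> 0" using B mult_nonneg_nonneg[OF nu T] by simp
  have "0 \<le> r * exp (- \<nu> * T)" using r mult_nonneg_nonneg[OF B0 rho] by simp
  then have r0: "r \<ge> 0" by (simp add: zero_le_mult_iff not_le[symmetric])
  show ?case
  proof (cases "k = 1")
    case True
    \<comment> \<open>The first mode decays, so its value at the horizon \<open>T\<close> bounds it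
      from below at all earlier times.\<close>
    have "r * exp (- \<nu> * T) \<le> r * exp (- \<nu> * t)"
      using r0 nu less.prems by (intro mult_left_mono) (simp_all add: mult_left_mono)
    with r have "B * \<rho> \<le> r * exp (- \<nu> * t)" by simp
    then show ?thesis
      using True r0 by (simp add: burgers_coeff_one[simplified] norm_mult)
  next
    case False
    then have k: "k \<ge> 2" using less.prems by simp
    define \<mu> where "\<mu> = \<nu> * (real k)\<^sup>2"
    define S where "S = (\<lambda>\<tau>. \<Sum>(k1, k2)\<in>conv_pairs k. cmod (burgers_coeff \<nu> (of_real r) k1 \<tau>) *
        cmod (burgers_coeff \<nu> (of_real r) k2 \<tau>))"
    \<comment> \<open>The time profile times the integrating factor. Its derivative
      \<open>h'\<close> is written with \<open>\<tau> ^ (k - 2)\<close> factored out, the power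
      occurring in the lower bound for \<open>S\<close>.\<close>
    define h where "h = (\<lambda>\<tau>. exp (\<mu> * \<tau>) * \<tau> ^ (k - 1))"
    define h' where "h' = (\<lambda>\<tau>. exp (\<mu> * \<tau>) * \<tau> ^ (k - 2) * ((real k - 1) + \<mu> * \<tau>))"
    have S: "(real k - 1) * (B\<^sup>2 * \<rho> ^ k * \<tau> ^ (k - 2)) \<le> S \<tau>" if "0 \<le> \<tau>" "\<tau> \<le> t" for \<tau>
    proof -
      have "B\<^sup>2 * \<rho> ^ k * \<tau> ^ (k - 2) \<le> cmod (burgers_coeff \<nu> (of_real r) k1 \<tau>) *
          cmod (burgers_coeff \<nu> (of_real r) k2 \<tau>)"
        if *: "k1 + k2 = k" "k1 \<ge> 1" "k2 \<ge> 1" for k1 k2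
      proof -
        have e: "k - 2 = (k1 - 1) + (k2 - 1)" "k = k1 + k2" using * by auto
        have "B\<^sup>2 * \<rho> ^ k * \<tau> ^ (k - 2) =
            (B * \<rho> ^ k1 * \<tau> ^ (k1 - 1)) * (B * \<rho> ^ k2 * \<tau> ^ (k2 - 1))"
          unfolding e(1) unfolding e(2) by (simp add: power_add power2_eq_square mult_ac)
        also have "\<dots> \<le> cmod (burgers_coeff \<nu> (of_real r) k1 \<tau>) *
            cmod (burgers_coeff \<nu> (of_real r) k2 \<tau>)"
          using * \<open>0 \<le> \<tau>\<close> \<open>\<tau> \<le> t\<close> less.prems B0 rho
          by (intro mult_mono less.IH) auto
        finally show ?thesis .
      qed
      then have "(\<Sum>p\<in>conv_pairs k. B\<^sup>2 * \<rho> ^ k * \<tau> ^ (k - 2)) \<le> S \<tau>"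
        unfolding S_def by (intro sum_mono) auto
      then show ?thesis
        unfolding sum_constant card_conv_pairs using k by (simp add: of_nat_diff)
    qed
    have h_deriv: "(h has_vector_derivative h' \<tau>) (at \<tau> within {0..t})" for \<tau>
    proof -
      \<comment> \<open>This turns the truncated differences \<open>k - 1\<close> and
        \<open>k - 2\<close> into \<open>Suc m\<close> and \<open>m\<close>.\<close>
      obtain m where m: "k = Suc (Suc m)"
        using k by (metis add_2_eq_Suc le_Suc_ex)
      have "((\<lambda>\<tau>. exp (\<mu> * \<tau>)) has_real_derivative exp (\<mu> * \<tau>) * \<mu>) (at \<tau> within {0..t})"
        by (auto intro!: derivative_eq_intros)
      moreover have "((\<lambda>\<tau>. \<tau> ^ Suc m) has_real_derivative real (Suc m) * \<tau> ^ m) (at \<tau> within {0..t})"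
        using DERIV_pow[of "Suc m"] by simp
      ultimately show ?thesis
        unfolding h_def h'_def m has_real_derivative_iff_has_vector_derivative[symmetric]
        by (simp add: algebra_simps del: power_Suc) (drule (1) DERIV_mult, simp add: algebra_simps)
    qed
    have "((\<lambda>\<tau>. B * \<rho> ^ k * h' \<tau>) has_integral B * \<rho> ^ k * (h t - h 0)) {0..t}"
      using less.prems h_deriv
      by (intro has_integral_mult_right fundamental_theorem_of_calculus) auto
    moreover have "((\<lambda>\<tau>. 3 * real k * (exp (\<mu> * \<tau>) * S \<tau>)) has_integral
        3 * real k * integral {0..t} (\<lambda>\<tau>. exp (\<mu> * \<tau>) * S \<tau>)) {0..t}"
      unfolding S_def case_prod_unfold
      by (intro has_integral_mult_right integrable_integral integrable_continuous_interval
          continuous_intros continuous_on_subset[OF continuous_on_burgers_coeff]) auto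
    moreover have "B * \<rho> ^ k * h' \<tau> \<le> 3 * real k * (exp (\<mu> * \<tau>) * S \<tau>)"
      if "\<tau> \<in> {0..t}" for \<tau>
    proof -
      have "B * \<rho> ^ k * h' \<tau> =
          (B * \<rho> ^ k * exp (\<mu> * \<tau>) * \<tau> ^ (k - 2)) * ((real k - 1) + \<mu> * \<tau>)"
        unfolding h'_def by simp
      also have "\<dots> \<le> (B * \<rho> ^ k * exp (\<mu> * \<tau>) * \<tau> ^ (k - 2)) * (3 * real k * (real k - 1) * B)"
        unfolding \<mu>_def using nu B k B0 rho that less.prems
        by (intro mult_left_mono subsolution_derivative_bound[where T = T]) auto
      also have "\<dots> = 3 * real k * (exp (\<mu> * \<tau>) * ((real k - 1) * (B\<^sup>2 * \<rho> ^ k * \<tau> ^ (k - 2))))"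
        by (simp add: power2_eq_square)
      also have "\<dots> \<le> 3 * real k * (exp (\<mu> * \<tau>) * S \<tau>)"
        using S that by (intro mult_left_mono) auto
      finally show ?thesis .
    qed
    ultimately have "B * \<rho> ^ k * (h t - h 0) \<le>
        3 * real k * integral {0..t} (\<lambda>\<tau>. exp (\<mu> * \<tau>) * S \<tau>)"
      by (rule has_integral_le)
    \<comment> \<open>Since \<open>k \<ge> 2\<close>, the exponent \<open>k - 1\<close> is positive
      and the boundary term at time zero vanishes.\<close>
    moreover have "h 0 = 0" using k by (simp add: h_def)
    ultimately have "exp (- \<mu> * t) * (B * \<rho> ^ k * h t) \<le>
        exp (- \<mu> * t) * (3 * real k * integral {0..t} (\<lambda>\<tau>. exp (\<mu> * \<tau>) * S \<tau>))"
      by (intro mult_left_mono) auto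
    moreover have "exp (- \<mu> * t) * (B * \<rho> ^ k * h t) = B * \<rho> ^ k * t ^ (k - 1)"
      unfolding h_def by (simp add: exp_minus)
    moreover have "exp (- \<mu> * t) * (3 * real k * integral {0..t} (\<lambda>\<tau>. exp (\<mu> * \<tau>) * S \<tau>))
        = cmod (burgers_coeff \<nu> (of_real r) k t)"
      unfolding cmod_burgers_coeff_rec[OF r0 k less.prems(2)] \<mu>_def S_def by simp
    ultimately show ?thesis by (simp only:)
  qed
qed

text \<open>A finite norm would force the squared moduli to tend to zero, against the uniform bound
  \<open>\<epsilon>\<^sup>2\<close>.\<close>

lemma L2_norm_sq_eq_top:
  assumes "\<epsilon> > 0" and "\<And>k. \<epsilon> \<le> cmod (c (Suc k))"
  shows "L2_norm_sq c = \<infinity>"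
proof (rule ccontr)
  assume "L2_norm_sq c \<noteq> \<infinity>"
  then have "summable (\<lambda>k. (cmod (c (Suc k)))\<^sup>2)"
    unfolding L2_norm_sq_def by (intro summable_suminf_not_top) auto
  then have "(\<lambda>k. (cmod (c (Suc k)))\<^sup>2) \<longlonglongrightarrow> 0"
    by (rule summable_LIMSEQ_zero)
  then have "\<epsilon>\<^sup>2 \<le> 0"
    by (rule LIMSEQ_le_const) (use assms in \<open>auto intro: power_mono\<close>)
  with assms(1) show False by simp
qed

theorem theorem2p1:
  fixes \<nu> :: real
  assumes "\<nu> \<ge> 0"
  shows "\<exists>T0>0. \<forall>T\<ge>T0. \<exists>a :: complex.
           L2_norm_sq (\<lambda>k. burgers_coeff \<nu> a k T) = \<infinity>"
\<comment> \<open>The threshold \<open>1\<close> keeps \<open>T\<close> positive, so that division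
  by \<open>T\<close> is legitimate; it is the same for all \<nu>.\<close>
proof (intro exI[of _ "1::real"] conjI allI impI)
  fix T :: real
  assume "T \<ge> 1"
  define B where "B = 1 + \<nu> * T"
  \<comment> \<open>Chosen so that \<open>r * exp (- \<nu> * T) = B * (1 / T)\<close>, which is
    equality in the amplitude condition of the lower bound with
    \<open>\<rho> = 1 / T\<close>.\<close>
  define r where "r = B / T * exp (\<nu> * T)"
  have "B > 0" unfolding B_def using assms \<open>T \<ge> 1\<close> by (simp add: add_pos_nonneg)
  have "B / T \<le> cmod (burgers_coeff \<nu> (of_real r) (Suc k) T)" for k
  proof -
    have "B * (1 / T) ^ Suc k * T ^ (Suc k - 1) \<le> cmod (burgers_coeff \<nu> (of_real r) (Suc k) T)"
      using assms \<open>T \<ge> 1\<close>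
      by (intro cmod_burgers_coeff_lower_bound[where T = T]) (simp_all add: r_def B_def mult.assoc flip: exp_add)
    \<comment> \<open>At time \<open>T\<close> the growth \<open>T ^ k\<close> cancels the decay of
      \<open>(1 / T) ^ k\<close>, which leaves a bound independent of \<open>k\<close>.\<close>
    moreover have "(1 / T) ^ k * T ^ k = 1"
      using \<open>T \<ge> 1\<close> by (simp flip: power_mult_distrib)
    then have "B * (1 / T) ^ Suc k * T ^ (Suc k - 1) = B / T" by simp
    ultimately show ?thesis by (simp only:)
  qed
  then have "L2_norm_sq (\<lambda>k. burgers_coeff \<nu> (of_real r) k T) = \<infinity>"
    using \<open>B > 0\<close> \<open>T \<ge> 1\<close> by (intro L2_norm_sq_eq_top[of "B / T"]) auto
  then show "\<exists>a. L2_norm_sq (\<lambda>k. burgers_coeff \<nu> a k T) = \<infinity>" ..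
qed simp

end
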